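(* Let $f:\mathbb{R}^n\to\mathbb{R}$ be $L$-smooth with optimal value $f^\ast$ and suppose $f$ has intrinsic dimension $s<n$, i.e. there is an orthogonal projection matrix $\Pi$ onto an $s$-dimensional subspace of $\mathbb{R}^n$ with $f(x)=f(\Pi x)$ for all $x\in\mathbb{R}^n$. Let $(x_k)$ be generated by classical stochastic subspace descent, $$x_k=x_{k-1}-\alpha P_{k-1}P_{k-1}^\top\nabla f(x_{k-1}),$$ where the $P_{k-1}\in\mathbb{R}^{n\times d}$ are i.i.d. uniformly (Haar) distributed on the Stiefel manifold of $n\times d$ matrices with orthonormal columns. Let $d,\alpha$ satisfy $$\max\left\{1,\,2\log\left(\frac{2n^2}{9s}\right)\right\}\le d\le\frac s{16},\qquad \alpha=\frac{n}{18sL}.$$ Then, for $\epsilon>0$, to obtain $\min_{1\le k\le N}\mathbb{E}\left[\|\nabla f(x_{k-1})\|^2\right]\le\epsilon^2$ it suffices that $$N\ge\frac{36Ls}{d\,\epsilon^2}\left(f(x_0)-f^\ast\right).$$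
   Context: $L$-smooth means $\|\nabla f(x)-\nabla f(y)\|\le L\|x-y\|$ for all $x,y$. Writing $R\in\mathbb{R}^{s\times n}$ for a matrix whose rows form an orthonormal basis of $\Pi\mathbb{R}^n$ (so $\Pi=R^\top R$) and $g(y)=f(R^\top y)$ for $y\in\mathbb{R}^s$, one has $f(x)=g(Rx)$. *)

theory Defs
  imports "HOL-Probability.Probability"
begin

definition grad :: "('v::euclidean_space \<Rightarrow> real) \<Rightarrow> 'v \<Rightarrow> 'v" where
  "grad f x = (THE v. GDERIV f x :> v)"

definition L_smooth :: "real \<Rightarrow> ('v::euclidean_space \<Rightarrow> real) \<Rightarrow> bool" where
  "L_smooth L f \<longleftrightarrow>
     (\<forall>x. f differentiable (at x)) \<and>
     (\<forall>x y. norm (grad f x - grad f y) \<le> L * norm (x - y))"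

definition orthogonal_projection_onto :: "real^'n^'n \<Rightarrow> (real^'n) set \<Rightarrow> bool" where
  "orthogonal_projection_onto A S \<longleftrightarrow>
     subspace S \<and> (\<forall>x. A *v x \<in> S \<and> (\<forall>y\<in>S. orthogonal (x - A *v x) y))"

text \<open>The dimension \<open>s\<close> is not required to be minimal.\<close>

definition intrinsic_dimension :: "(real^'n \<Rightarrow> real) \<Rightarrow> nat \<Rightarrow> bool" where
  "intrinsic_dimension f s \<longleftrightarrow>
     (\<exists>A S. orthogonal_projection_onto A S \<and> dim S = s \<and> (\<forall>x. f x = f (A *v x)))"

text \<open>The type \<^typ>\<open>real^'d^'n\<close> has \<open>'n\<close>-indexed rows and \<open>'d\<close>-indexed columns,
  that is, it consists of the \<open>n \<times> d\<close> matrices.\<close>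

definition stiefel :: "(real^'d^'n) set" where
  "stiefel = {P. transpose P ** P = mat 1}"

text \<open>The uniform (Haar) distribution on the Stiefel manifold is its unique Borel probability
  measure invariant under the transitive action of the orthogonal group by left multiplication.
  It is represented as a measure on all \<open>n \<times> d\<close> matrices that is concentrated on
  the manifold.\<close>

definition haar_stiefel :: "(real^'d^'n) measure \<Rightarrow> bool" where
  "haar_stiefel \<mu> \<longleftrightarrow>
     prob_space \<mu> \<and> sets \<mu> = sets borel \<and> (AE P in \<mu>. P \<in> stiefel) \<and>
     (\<forall>Q :: real^'n^'n. orthogonal_matrix Q \<longrightarrow> distr \<mu> borel (\<lambda>P. Q ** P) = \<mu>)"

end

theory Submission
  imports Defs
begin

text \<open>
  Write \<open>W = P P\<^sup>T\<close>. Invariance under reflections shows that the moments of the entries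
  \<open>\<langle>u, W v\<rangle>\<close> do not depend on the choice of orthonormal \<open>u\<close>, \<open>v\<close>. The trace of \<open>W\<close> gives
  \<open>E \<langle>u, W u\<rangle> = d/n\<close>; polarization of \<open>u \<mapsto> E \<langle>u, W u\<rangle>\<^sup>2\<close> together with the trace and \<open>W\<^sup>2 = W\<close> gives
  \<open>E \<langle>u, W u\<rangle>\<^sup>2 = d(d+2)/(n(n+2))\<close> and \<open>E \<langle>u, W v\<rangle>\<^sup>2 \<le> d/(n(n-1))\<close>. Summing over an orthonormal basis
  of the range of \<open>\<Pi>\<close> bounds \<open>E \<parallel>\<Pi> W u\<parallel>\<^sup>2\<close> by \<open>18 s d/n\<^sup>2\<close>; no concentration inequality is needed.
  Since \<open>f\<close> only sees the component \<open>\<Pi> (x\<^sub>k - x\<^sub>k\<^sub>-\<^sub>1)\<close> of a step, the descent lemma and the independence of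
  \<open>x\<^sub>k\<^sub>-\<^sub>1\<close> and \<open>P\<^sub>k\<^sub>-\<^sub>1\<close> give an expected decrease of at least
  \<open>d/(36 s L) E \<parallel>\<nabla>f(x\<^sub>k\<^sub>-\<^sub>1)\<parallel>\<^sup>2\<close> per iteration, and these decreases telescope.
\<close>

subsection \<open>Matrices with orthonormal columns\<close>

text \<open>The witness is the Householder reflection along \<open>a - b\<close>. Its fixed vectors
  matter as well: they let one vector of an orthogonal pair be moved while the other stays in
  place.\<close>

lemma orthogonal_matrix_swap_exists:
  fixes a b :: "real^'n"
  assumes "norm a = norm b"
  obtains Q :: "real^'n^'n"
  where "orthogonal_matrix Q" "Q *v a = b" "\<And>y. y \<bullet> (a - b) = 0 \<Longrightarrow> Q *v y = y"
proof -
  define w where "w = a - b"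
  \<comment> \<open>If \<open>a = b\<close>, then \<open>w\<close> is zero and \<open>h\<close> is
    the identity, so this case needs no other witness.\<close>
  define h where "h x = x - (2 * (w \<bullet> x) / (w \<bullet> w)) *\<^sub>R w" for x
  have lin: "linear h"
    unfolding h_def by (rule linearI) (simp_all add: algebra_simps add_divide_distrib)
  have "h x \<bullet> h y = x \<bullet> y" for x y
  proof (cases "w = 0")
    case False
    then have "w \<bullet> w \<noteq> 0" by simp
    then show ?thesis
      by (simp add: h_def inner_diff_left inner_diff_right field_simps inner_commute)
  qed (simp add: h_def)
  with lin have "orthogonal_transformation h"
    by (simp add: orthogonal_transformation_def)
  then have orth: "orthogonal_matrix (matrix h)"
    by (simp add: orthogonal_transformation_matrix)
  have app: "matrix h *v y = h y" for y
    using lin by (simp add: matrix_works)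
  \<comment> \<open>Equality of the norms enters here. It makes the coefficient of \<open>w\<close>
    in \<open>h a\<close> equal to 1, so that \<open>h a = a - w = b\<close>.\<close>
  have "w \<bullet> w = 2 * (w \<bullet> a)"
    using assms unfolding w_def norm_eq_sqrt_inner
    by (simp add: algebra_simps inner_commute)
  then have "h a = b"
    by (cases "w = 0") (auto simp: h_def w_def)
  moreover have "h y = y" if "y \<bullet> (a - b) = 0" for y
    using that by (simp add: h_def w_def inner_commute)
  ultimately show ?thesis
    using that[of "matrix h"] orth app by simp
qed

section \<open>Continuity of the matrix operations\<close>

lemma continuous_on_vector_matrix_mult [continuous_intros]:
  fixes f :: "'a::topological_space \<Rightarrow> real^'n" and g :: "'a \<Rightarrow> real^'m^'n"
  assumes "continuous_on S f" "continuous_on S g"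
  shows "continuous_on S (\<lambda>x. f x v* g x)"
  unfolding vector_matrix_mult_def by (intro continuous_intros assms)

lemma continuous_on_matrix_vector_mult [continuous_intros]:
  fixes f :: "'a::topological_space \<Rightarrow> real^'n^'m" and g :: "'a \<Rightarrow> real^'n"
  assumes "continuous_on S f" "continuous_on S g"
  shows "continuous_on S (\<lambda>x. f x *v g x)"
  unfolding matrix_vector_mult_def by (intro continuous_intros assms)

lemma continuous_on_matrix_matrix_mult [continuous_intros]:
  fixes f :: "'a::topological_space \<Rightarrow> real^'n^'m" and g :: "'a \<Rightarrow> real^'k^'n"
  assumes "continuous_on S f" "continuous_on S g"
  shows "continuous_on S (\<lambda>x. f x ** g x)"
  unfolding matrix_matrix_mult_def by (intro continuous_intros assms)

lemma continuous_on_transpose [continuous_intros]: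
  fixes f :: "'a::topological_space \<Rightarrow> real^'n^'m"
  assumes "continuous_on S f"
  shows "continuous_on S (\<lambda>x. transpose (f x))"
  unfolding transpose_def by (intro continuous_intros assms)

section \<open>The bilinear form of P P^T\<close>

text \<open>This is the entry <u, W v> of W = P P^T, since \<open>u v* P\<close> is P^T u. Written
  in this way the form is visibly symmetric and nonnegative on the diagonal.\<close>

definition proj_form :: "real^'d^'n \<Rightarrow> real^'n \<Rightarrow> real^'n \<Rightarrow> real" where
  "proj_form P u v = (u v* P) \<bullet> (v v* P)"

lemma proj_form_eq_inner: "proj_form P u v = u \<bullet> ((P ** transpose P) *v v)"
  by (simp add: proj_form_def dot_lmul_matrix flip: matrix_vector_mul_assoc)

lemma proj_form_commute: "proj_form P u v = proj_form P v u"
  by (simp add: proj_form_def inner_commute)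

lemma proj_form_add_left: "proj_form P (u + v) w = proj_form P u w + proj_form P v w"
  and proj_form_scale_left: "proj_form P (c *\<^sub>R u) w = c * proj_form P u w"
  and proj_form_minus_left: "proj_form P (- u) w = - proj_form P u w"
  by (simp_all add: proj_form_eq_inner inner_left_distrib)

lemma proj_form_add_right: "proj_form P w (u + v) = proj_form P w u + proj_form P w v"
  and proj_form_scale_right: "proj_form P w (c *\<^sub>R u) = c * proj_form P w u"
  and proj_form_minus_right: "proj_form P w (- u) = - proj_form P w u"
  by (metis proj_form_commute proj_form_add_left proj_form_scale_left proj_form_minus_left)+

text \<open>A factor on the left of \<open>P\<close> can be moved onto the two vectors. This turns
  the left invariance of the distribution into freedom to rotate \<open>u\<close> and
  \<open>v\<close>.\<close>

lemma proj_form_matrix_mul: "proj_form (A ** P) u v = proj_form P (transpose A *v u) (transpose A *v v)"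
  by (simp add: proj_form_def flip: vector_matrix_mul_assoc)

lemma continuous_on_proj_form [continuous_intros]:
  fixes f :: "'a::topological_space \<Rightarrow> real^'d^'n"
  assumes "continuous_on S f" "continuous_on S u" "continuous_on S v"
  shows "continuous_on S (\<lambda>x. proj_form (f x) (u x) (v x))"
  unfolding proj_form_def by (intro continuous_intros assms)

section \<open>Identities on the Stiefel manifold and its compactness\<close>

lemma stiefel_norm_mult:
  assumes "P \<in> stiefel"
  shows "norm (P *v y) = norm y"
proof -
  have "(P *v y) \<bullet> (P *v y) = y \<bullet> (transpose P *v (P *v y))"
    by (simp add: dot_lmul_matrix[symmetric] inner_commute)
  also have "\<dots> = y \<bullet> y"
    using assms by (simp add: matrix_vector_mul_assoc stiefel_def)
  finally show ?thesis by (simp add: norm_eq_sqrt_inner)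
qed

text \<open>\<open>P\<close> is an isometry, so |P P^T u| = |P^T u|. This plays the part of W^2 =
  W.\<close>

lemma norm_stiefel_proj:
  assumes "P \<in> stiefel"
  shows "(norm ((P ** transpose P) *v u))\<^sup>2 = proj_form P u u"
  using stiefel_norm_mult[OF assms, of "transpose P *v u"]
  by (simp add: proj_form_def power2_norm_eq_inner norm_eq_sqrt_inner flip: matrix_vector_mul_assoc)

lemma norm_stiefel_proj_le:
  assumes "P \<in> stiefel"
  shows "norm ((P ** transpose P) *v u) \<le> norm u"
proof -
  let ?w = "(P ** transpose P) *v u"
  have "(norm ?w)\<^sup>2 \<le> norm u * norm ?w"
    using norm_stiefel_proj[OF assms, of u] norm_cauchy_schwarz[of u ?w]
    by (simp add: proj_form_eq_inner)
  then show ?thesis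
    by (metis mult_le_cancel_right norm_ge_zero norm_le_zero_iff order_trans power2_eq_square zero_less_norm_iff)
qed


lemma axis_vector_matrix_mult: "axis i (1::real) v* P = P $ i"
  by (simp add: vector_matrix_mult_def vec_eq_iff axis_def if_distribR if_distrib cong: if_cong)

text \<open>The trace of P P^T equals the trace of P^T P, which is the identity of size d.\<close>

lemma sum_proj_form_axis:
  fixes P :: "real^'d^'n"
  assumes "P \<in> stiefel"
  shows "(\<Sum>i\<in>UNIV. proj_form P (axis i 1) (axis i 1)) = real CARD('d)"
proof -
  have "(\<Sum>i\<in>UNIV. proj_form P (axis i 1) (axis i 1)) = (\<Sum>i\<in>UNIV. \<Sum>j\<in>UNIV. P$i$j * P$i$j)"
    by (simp add: proj_form_def axis_vector_matrix_mult inner_vec_def)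
  also have "\<dots> = (\<Sum>j\<in>UNIV. (transpose P ** P)$j$j)"
    by (subst sum.swap) (simp add: matrix_matrix_mult_def transpose_def)
  also have "\<dots> = real CARD('d)"
    using assms by (simp add: stiefel_def mat_def)
  finally show ?thesis .
qed

text \<open>The summands are the squared coordinates of W u, so the sum is |W u|^2 = <u, W
  u>.\<close>

lemma sum_proj_form_axis_square:
  assumes "P \<in> stiefel"
  shows "(\<Sum>i\<in>UNIV. (proj_form P u (axis i 1))\<^sup>2) = proj_form P u u"
proof -
  have "proj_form P u (axis i 1) = ((P ** transpose P) *v u) $ i" for i
    by (subst proj_form_commute) (simp add: proj_form_eq_inner inner_axis')
  then show ?thesis
    by (simp add: norm_stiefel_proj[OF assms, symmetric] power2_norm_eq_inner inner_vec_def)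
      (simp add: power2_eq_square)
qed

text \<open>The squared Frobenius norm of \<open>P\<close> is the trace of P P^T, that is d.
  Compactness later makes continuous functions of \<open>P\<close> bounded, hence
  integrable.\<close>

lemma compact_stiefel: "compact (stiefel :: (real^'d^'n) set)"
proof -
  have "closed (stiefel :: (real^'d^'n) set)"
    unfolding stiefel_def by (intro closed_Collect_eq continuous_intros)
  moreover have "bounded (stiefel :: (real^'d^'n) set)"
  proof (rule boundedI)
    fix P :: "real^'d^'n" assume P: "P \<in> stiefel"
    have "P \<bullet> P = (\<Sum>i\<in>UNIV. proj_form P (axis i 1) (axis i 1))"
      by (simp add: inner_vec_def proj_form_def axis_vector_matrix_mult)
    then show "norm P \<le> sqrt (real CARD('d))"
      using sum_proj_form_axis[OF P] by (simp add: norm_eq_sqrt_inner)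
  qed
  ultimately show ?thesis
    by (simp add: compact_eq_bounded_closed)
qed

subsection \<open>Orthogonal projections\<close>

text \<open>The residual of the point \<open>A *v x\<close> lies in \<open>S\<close> and is
  orthogonal to \<open>S\<close>, so it vanishes.\<close>

lemma orthogonal_projection_idem:
  assumes "orthogonal_projection_onto A S"
  shows "A *v (A *v x) = A *v x"
proof -
  have "A *v x \<in> S" "A *v (A *v x) \<in> S" and "subspace S"
    and orth: "\<And>y z. z \<in> S \<Longrightarrow> (y - A *v y) \<bullet> z = 0"
    using assms by (auto simp: orthogonal_projection_onto_def orthogonal_def)
  then have "(A *v x - A *v (A *v x)) \<bullet> (A *v x - A *v (A *v x)) = 0"
    by (intro orth subspace_diff)
  then show ?thesis
    by simp
qed

lemma norm_orthogonal_projection_le: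
  assumes "orthogonal_projection_onto A S"
  shows "norm (A *v x) \<le> norm x"
proof -
  have "orthogonal (x - A *v x) (A *v x)"
    using assms by (simp add: orthogonal_projection_onto_def)
  from norm_add_Pythagorean[OF this]
  have "(norm x)\<^sup>2 = (norm (x - A *v x))\<^sup>2 + (norm (A *v x))\<^sup>2"
    by (simp only: diff_add_cancel)
  then have "(norm (A *v x))\<^sup>2 \<le> (norm x)\<^sup>2"
    by (metis le_add_same_cancel2 zero_le_power2)
  then show ?thesis
    by (rule power2_le_imp_le) simp
qed

text \<open>Expanding in an orthonormal basis of \<open>S\<close> reduces the norm of a projected
  vector to scalar entries <b, x>, whose moments can be computed one at a time.\<close>

lemma orthogonal_projection_orthonormal_basis:
  assumes "orthogonal_projection_onto A S"
  obtains B where "finite B" "card B = dim S" "\<And>b. b \<in> B \<Longrightarrow> norm b = 1"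
    "\<And>x. (norm (A *v x))\<^sup>2 = (\<Sum>b\<in>B. (b \<bullet> x)\<^sup>2)"
proof -
  have S: "subspace S" "\<And>x. A *v x \<in> S"
    and orth: "\<And>y z. z \<in> S \<Longrightarrow> (y - A *v y) \<bullet> z = 0"
    using assms by (auto simp: orthogonal_projection_onto_def orthogonal_def)
  obtain B where B: "B \<subseteq> S" "pairwise orthogonal B" "\<And>b. b \<in> B \<Longrightarrow> norm b = 1"
    "independent B" "card B = dim S" "span B = S"
    using orthonormal_basis_subspace[OF S(1)] by blast
  have fin: "finite B"
    using B(4) by (rule independent_imp_finite)
  have "(norm (A *v x))\<^sup>2 = (\<Sum>b\<in>B. (b \<bullet> x)\<^sup>2)" for x
  proof -
    have "(norm (A *v x))\<^sup>2 = (A *v x) \<bullet> (\<Sum>b\<in>B. ((A *v x) \<bullet> b) *\<^sub>R b)"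
      using S(2)[of x] B fin by (subst orthonormal_basis_expand) (auto simp: power2_norm_eq_inner)
    also have "\<dots> = (\<Sum>b\<in>B. ((A *v x) \<bullet> b)\<^sup>2)"
      by (simp add: inner_sum_right power2_eq_square)
    also have "\<dots> = (\<Sum>b\<in>B. (b \<bullet> x)\<^sup>2)"
      using orth[of _ x] B(1) by (intro sum.cong) (auto simp: inner_diff_left inner_diff_right inner_commute)
    finally show ?thesis .
  qed
  then show ?thesis using that fin B by blast
qed

subsection \<open>Moments of the uniform distribution on the Stiefel manifold\<close>

locale haar_stiefel_measure =
  fixes \<mu> :: "(real^'d^'n) measure"
  assumes haar: "haar_stiefel \<mu>"
begin

sublocale prob_space \<mu>
  using haar by (simp add: haar_stiefel_def)

lemma sets_haar [simp, measurable_cong]: "sets \<mu> = sets borel"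
  using haar by (simp add: haar_stiefel_def)

lemma AE_stiefel: "AE P in \<mu>. P \<in> stiefel"
  using haar by (simp add: haar_stiefel_def)

text \<open>The measure is concentrated on a compact set, on which a continuous function is bounded.
  All moments used below are therefore finite.\<close>

lemma integrable_continuous:
  fixes h :: "real^'d^'n \<Rightarrow> real"
  assumes "continuous_on UNIV h"
  shows "integrable \<mu> h"
proof -
  have "bounded (h ` stiefel)"
    using assms compact_stiefel continuous_on_subset
    by (intro compact_imp_bounded compact_continuous_image) auto
  then obtain B where B: "\<And>P. P \<in> stiefel \<Longrightarrow> norm (h P) \<le> B"
    by (auto simp: bounded_iff)
  have "h \<in> borel_measurable \<mu>"
    using borel_measurable_continuous_onI[OF assms] by simp
  then show ?thesis
    using AE_stiefel B by (intro integrable_const_bound[of _ B]) auto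
qed

lemma integral_orthogonal_left:
  fixes h :: "real^'d^'n \<Rightarrow> real"
  assumes "continuous_on UNIV h" "orthogonal_matrix Q"
  shows "(\<integral>P. h (Q ** P) \<partial>\<mu>) = (\<integral>P. h P \<partial>\<mu>)"
proof -
  have "(\<lambda>P::real^'d^'n. Q ** P) \<in> borel_measurable \<mu>"
    using borel_measurable_continuous_onI[of "\<lambda>P::real^'d^'n. Q ** P"]
    by (simp add: continuous_intros)
  then have "(\<integral>P. h (Q ** P) \<partial>\<mu>) = (\<integral>P. h P \<partial>distr \<mu> borel (\<lambda>P. Q ** P))"
    using borel_measurable_continuous_onI[OF assms(1)] by (simp add: integral_distr)
  then show ?thesis
    using haar assms(2) by (simp add: haar_stiefel_def)
qed

text \<open>Invariance is applied to the transpose of \<open>Q\<close>, because moving a left factor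
  onto the vectors transposes it.\<close>

lemma integral_proj_form_orthogonal:
  fixes h :: "real \<Rightarrow> real"
  assumes "continuous_on UNIV h" "orthogonal_matrix Q"
  shows "(\<integral>P. h (proj_form P (Q *v u) (Q *v v)) \<partial>\<mu>) = (\<integral>P. h (proj_form P u v) \<partial>\<mu>)"
proof -
  have "continuous_on UNIV (\<lambda>P::real^'d^'n. h (proj_form P u v))"
    by (intro continuous_on_compose2[OF assms(1)] continuous_intros) auto
  from integral_orthogonal_left[OF this, of "transpose Q"] assms(2)
  show ?thesis
    by (simp add: proj_form_matrix_mul orthogonal_matrix_transpose)
qed

lemma integral_proj_form_diag_eq:
  fixes h :: "real \<Rightarrow> real"
  assumes "continuous_on UNIV h" "norm u = norm v"
  shows "(\<integral>P. h (proj_form P u u) \<partial>\<mu>) = (\<integral>P. h (proj_form P v v) \<partial>\<mu>)"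
proof -
  obtain Q :: "real^'n^'n" where "orthogonal_matrix Q" "Q *v u = v"
    using orthogonal_matrix_swap_exists[OF assms(2)] by metis
  with integral_proj_form_orthogonal[OF assms(1), of Q u u] show ?thesis by simp
qed

text \<open>Two reflections suffice. The first takes \<open>u\<close> to \<open>u'\<close>; the
  second takes the image of \<open>v\<close> to \<open>v'\<close> and fixes \<open>u'\<close>,
  because the difference of that image and \<open>v'\<close> is orthogonal to
  \<open>u'\<close>.\<close>

lemma integral_proj_form_orthogonal_eq:
  fixes h :: "real \<Rightarrow> real"
  assumes h: "continuous_on UNIV h"
    and "norm u = norm u'" "norm v = norm v'" "u \<bullet> v = 0" "u' \<bullet> v' = 0"
  shows "(\<integral>P. h (proj_form P u v) \<partial>\<mu>) = (\<integral>P. h (proj_form P u' v') \<partial>\<mu>)"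
proof -
  obtain Q :: "real^'n^'n" where Q: "orthogonal_matrix Q" "Q *v u = u'"
    using orthogonal_matrix_swap_exists[OF assms(2)] by metis
  have ot: "orthogonal_transformation ((*v) Q)"
    using Q(1) by (simp add: orthogonal_transformation_matrix)
  have nv: "norm (Q *v v) = norm v'"
    using orthogonal_transformation_norm[OF ot] assms(3) by simp
  have "u' \<bullet> (Q *v v) = 0"
    using ot Q(2) assms(4) unfolding orthogonal_transformation_def by metis
  then have "u' \<bullet> (Q *v v - v') = 0"
    using assms(5) by (simp add: inner_diff_right)
  then obtain R :: "real^'n^'n" where R: "orthogonal_matrix R" "R *v (Q *v v) = v'" "R *v u' = u'"
    using orthogonal_matrix_swap_exists[OF nv] by metis
  show ?thesis
    using integral_proj_form_orthogonal[OF h Q(1), of u v]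
      integral_proj_form_orthogonal[OF h R(1), of u' "Q *v v"] Q(2) R(2,3) by simp
qed

lemmas continuous_on_proj_form_const =
  continuous_on_proj_form[OF continuous_on_id continuous_on_const continuous_on_const]

section \<open>First and second moments of the entries\<close>

text \<open>All n diagonal entries have the same mean by symmetry, and they add up to the trace
  d.\<close>

lemma integral_proj_form_diag:
  assumes "norm u = 1"
  shows "(\<integral>P. proj_form P u u \<partial>\<mu>) = real CARD('d) / real CARD('n)"
proof -
  have "(\<integral>P. proj_form P (axis i 1) (axis i 1) \<partial>\<mu>) = (\<integral>P. proj_form P u u \<partial>\<mu>)" for i
    using integral_proj_form_diag_eq[of "\<lambda>x. x" "axis i 1" u] assms by simp
  then have "real CARD('n) * (\<integral>P. proj_form P u u \<partial>\<mu>)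
      = (\<Sum>i\<in>UNIV. \<integral>P. proj_form P (axis i 1) (axis i 1) \<partial>\<mu>)"
    by simp
  also have "\<dots> = (\<integral>P. (\<Sum>i\<in>UNIV. proj_form P (axis i 1) (axis i 1)) \<partial>\<mu>)"
    by (intro Bochner_Integration.integral_sum[symmetric] integrable_continuous continuous_intros)
  also have "\<dots> = (\<integral>P. real CARD('d) \<partial>\<mu>)"
    using AE_stiefel by (intro integral_cong_AE borel_measurable_integrable integrable_continuous continuous_intros)
      (auto simp: sum_proj_form_axis)
  finally show ?thesis
    by (simp add: field_simps prob_space)
qed

text \<open>Both u + v and u - v have norm sqrt 2, so the squared form has mean 4m at each, with m
  the value at a unit vector. Expanding both squares and adding gives the relation.\<close>

lemma integral_proj_form_polarization:
  assumes "norm u = 1" "norm v = 1" "u \<bullet> v = 0"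
  shows "(\<integral>P. proj_form P u u * proj_form P v v \<partial>\<mu>) + 2 * (\<integral>P. (proj_form P u v)\<^sup>2 \<partial>\<mu>)
    = (\<integral>P. (proj_form P u u)\<^sup>2 \<partial>\<mu>)"
proof -
  let ?E = "\<lambda>h. (\<integral>P. h P \<partial>\<mu>)"
  define m where "m = ?E (\<lambda>P. (proj_form P u u)\<^sup>2)"
  have m: "?E (\<lambda>P. (proj_form P w w)\<^sup>2) = 4 * m" if "(norm w)\<^sup>2 = 2" for w
  proof -
    \<comment> \<open>Scaling \<open>u\<close> by sqrt 2 doubles the quadratic form, so its square
      gains the factor 4.\<close>
    have "norm w = norm (sqrt 2 *\<^sub>R u)"
      using that assms(1) by (simp add: real_sqrt_unique)
    then have "?E (\<lambda>P. (proj_form P w w)\<^sup>2) = ?E (\<lambda>P. (proj_form P (sqrt 2 *\<^sub>R u) (sqrt 2 *\<^sub>R u))\<^sup>2)"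
      by (intro integral_proj_form_diag_eq continuous_intros)
    then show ?thesis
      by (simp add: proj_form_scale_left proj_form_scale_right m_def power_mult_distrib flip: mult.assoc)
  qed
  have plus: "?E (\<lambda>P. (proj_form P (u + v) (u + v))\<^sup>2) = 4 * m"
    using assms by (intro m) (simp add: power2_norm_eq_inner inner_left_distrib inner_right_distrib
        inner_commute norm_eq_1)
  have minus: "?E (\<lambda>P. (proj_form P (u + - v) (u + - v))\<^sup>2) = 4 * m"
    using assms by (intro m) (simp add: power2_norm_eq_inner inner_left_distrib inner_right_distrib
        inner_commute norm_eq_1 inner_diff_left inner_diff_right)
  have v: "?E (\<lambda>P. (proj_form P v v)\<^sup>2) = m"
    unfolding m_def using assms by (intro integral_proj_form_diag_eq continuous_intros) simp
  note int = integrable_continuous continuous_intros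
  \<comment> \<open>In the sum of the two squares the terms odd in <u, W v> cancel. The difference
    is written \<open>u + - v\<close> so that the rules for sums and negatives apply.\<close>
  have "8 * m = ?E (\<lambda>P. (proj_form P (u + v) (u + v))\<^sup>2 + (proj_form P (u + - v) (u + - v))\<^sup>2)"
    by (subst Bochner_Integration.integral_add) (intro int | simp only: plus minus)+
  also have "\<dots> = ?E (\<lambda>P. 2 * (proj_form P u u)\<^sup>2 + (2 * (proj_form P v v)\<^sup>2
      + (4 * (proj_form P u u * proj_form P v v) + 8 * (proj_form P u v)\<^sup>2)))"
    by (simp only: proj_form_add_left proj_form_add_right proj_form_minus_left proj_form_minus_right
          proj_form_commute[of _ v u])
      (simp add: power2_eq_square algebra_simps)
  also have "\<dots> = 2 * m + (2 * m + (4 * ?E (\<lambda>P. proj_form P u u * proj_form P v v)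
      + 8 * ?E (\<lambda>P. (proj_form P u v)\<^sup>2)))"
    by (subst Bochner_Integration.integral_add, (intro int)+)+ (simp add: v flip: m_def)
  finally show ?thesis
    by (simp add: m_def)
qed

lemma integral_proj_form_axis_sum:
  assumes "continuous_on UNIV h"
  shows "(\<Sum>j\<in>UNIV. \<integral>P. h P * proj_form P (axis j 1) (axis j 1) \<partial>\<mu>)
    = real CARD('d) * (\<integral>P. h P \<partial>\<mu>)"
proof -
  have "(\<Sum>j\<in>UNIV. \<integral>P. h P * proj_form P (axis j 1) (axis j 1) \<partial>\<mu>)
      = (\<integral>P. (\<Sum>j\<in>UNIV. h P * proj_form P (axis j 1) (axis j 1)) \<partial>\<mu>)"
    by (intro Bochner_Integration.integral_sum[symmetric] integrable_continuous continuous_intros assms)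
  also have "\<dots> = (\<integral>P. real CARD('d) * h P \<partial>\<mu>)"
    using AE_stiefel by (intro integral_cong_AE borel_measurable_integrable integrable_continuous continuous_intros assms)
      (auto simp: sum_proj_form_axis simp flip: sum_distrib_left)
  finally show ?thesis by simp
qed

lemma integral_proj_form_axis_square_sum:
  "(\<Sum>j\<in>UNIV. \<integral>P. (proj_form P u (axis j 1))\<^sup>2 \<partial>\<mu>) = (\<integral>P. proj_form P u u \<partial>\<mu>)"
proof -
  have "(\<Sum>j\<in>UNIV. \<integral>P. (proj_form P u (axis j 1))\<^sup>2 \<partial>\<mu>)
      = (\<integral>P. (\<Sum>j\<in>UNIV. (proj_form P u (axis j 1))\<^sup>2) \<partial>\<mu>)"
    by (intro Bochner_Integration.integral_sum[symmetric] integrable_continuous continuous_intros)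
  also have "\<dots> = (\<integral>P. proj_form P u u \<partial>\<mu>)"
    using AE_stiefel by (intro integral_cong_AE borel_measurable_integrable integrable_continuous continuous_intros)
      (auto simp: sum_proj_form_axis_square)
  finally show ?thesis .
qed

text \<open>The sum of \<open>?t j\<close> over j is computed twice. Polarization gives m for each j
  other than i, and the two integrands coincide for j = i, giving 3m; the total is (n+2)m. The trace
  and the identity for squared entries give (d^2 + 2d)/n.\<close>

lemma integral_proj_form_diag_square:
  assumes "norm u = 1"
  shows "(\<integral>P. (proj_form P u u)\<^sup>2 \<partial>\<mu>)
    = real CARD('d) * (real CARD('d) + 2) / (real CARD('n) * (real CARD('n) + 2))"
proof -
  fix i :: 'n
  let ?n = "real CARD('n)" and ?d = "real CARD('d)"
  let ?e = "\<lambda>j::'n. axis j (1::real)"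
  define m where "m = (\<integral>P. (proj_form P u u)\<^sup>2 \<partial>\<mu>)"
  have m: "(\<integral>P. (proj_form P (?e i) (?e i))\<^sup>2 \<partial>\<mu>) = m"
    unfolding m_def using assms by (intro integral_proj_form_diag_eq continuous_intros) simp
  let ?t = "\<lambda>j. (\<integral>P. proj_form P (?e i) (?e i) * proj_form P (?e j) (?e j) \<partial>\<mu>)
      + 2 * (\<integral>P. (proj_form P (?e i) (?e j))\<^sup>2 \<partial>\<mu>)"
  have "?t i = 3 * m"
    using m by (simp add: power2_eq_square)
  moreover have "?t j = m" if "j \<noteq> i" for j
    using integral_proj_form_polarization[of "?e i" "?e j"] that m by (simp add: inner_axis_axis)
  ultimately have "(\<Sum>j\<in>UNIV. ?t j) = 3 * m + (?n - 1) * m"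
    by (subst sum.remove[of _ i]) (auto simp: of_nat_diff card_Diff_singleton)
  moreover have "(\<Sum>j\<in>UNIV. ?t j) = ?d * (?d / ?n) + 2 * (?d / ?n)"
    by (simp add: sum.distrib integral_proj_form_axis_sum integral_proj_form_axis_square_sum
        integral_proj_form_diag continuous_on_proj_form_const flip: sum_distrib_left)
  ultimately have "(?n + 2) * m = ?d * (?d + 2) / ?n"
    by (simp add: field_simps)
  then have "m * (?n * (?n + 2)) = ?d * (?d + 2)"
    by (simp add: field_simps)
  moreover have "?n * (?n + 2) \<noteq> 0"
    by (simp add: add_nonneg_eq_0_iff)
  ultimately show ?thesis
    by (metis eq_divide_eq m_def)
qed

text \<open>By symmetry the n - 1 off-diagonal entries of a row have equal second moments. Together
  with the squared diagonal entry their squares sum to that diagonal entry, whose mean is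
  d/n.\<close>

lemma integral_proj_form_offdiag_square_le:
  assumes "u \<bullet> v = 0" "norm u = 1"
  shows "(real CARD('n) - 1) * (\<integral>P. (proj_form P u v)\<^sup>2 \<partial>\<mu>)
    \<le> real CARD('d) / real CARD('n) * (norm v)\<^sup>2"
proof -
  fix i :: 'n
  let ?n = "real CARD('n)" and ?d = "real CARD('d)"
  let ?e = "\<lambda>j::'n. axis j (1::real)"
  define c where "c = (\<integral>P. (proj_form P u v)\<^sup>2 \<partial>\<mu>)"
  have "(norm v)\<^sup>2 * (\<integral>P. (proj_form P (?e i) (?e j))\<^sup>2 \<partial>\<mu>) = c" if "j \<noteq> i" for j
  proof -
    \<comment> \<open>The axis vector is scaled to the length of \<open>v\<close>, so that the two
      orthogonal pairs have matching norms.\<close>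
    have "(\<integral>P. (proj_form P (?e i) (norm v *\<^sub>R ?e j))\<^sup>2 \<partial>\<mu>) = c"
      unfolding c_def using assms that
      by (intro integral_proj_form_orthogonal_eq continuous_intros) (auto simp: inner_axis_axis)
    then show ?thesis
      by (simp add: proj_form_scale_right power_mult_distrib)
  qed
  then have "(?n - 1) * c = (\<Sum>j\<in>UNIV - {i}. (norm v)\<^sup>2 * (\<integral>P. (proj_form P (?e i) (?e j))\<^sup>2 \<partial>\<mu>))"
    by (simp add: of_nat_diff card_Diff_singleton)
  \<comment> \<open>Adding the nonnegative term j = i completes the row; this is the only loss in
    the estimate.\<close>
  also have "\<dots> \<le> (\<Sum>j\<in>UNIV. (norm v)\<^sup>2 * (\<integral>P. (proj_form P (?e i) (?e j))\<^sup>2 \<partial>\<mu>))"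
    by (intro sum_mono2) auto
  also have "\<dots> = (norm v)\<^sup>2 * (?d / ?n)"
    by (simp add: integral_proj_form_axis_square_sum integral_proj_form_diag flip: sum_distrib_left)
  finally show ?thesis
    by (simp add: c_def mult.commute)
qed

lemma integral_inner_stiefel_proj:
  "(\<integral>P. u \<bullet> ((P ** transpose P) *v u) \<partial>\<mu>) = real CARD('d) / real CARD('n) * (norm u)\<^sup>2"
proof (cases "u = 0")
  case False
  define v where "v = u /\<^sub>R norm u"
  define r where "r = norm u"
  have v: "norm v = 1" and u: "u = r *\<^sub>R v"
    using False by (simp_all add: v_def r_def)
  have "u \<bullet> ((P ** transpose P) *v u) = r\<^sup>2 * proj_form P v v" for P :: "real^'d^'n"
    unfolding proj_form_eq_inner[symmetric] u
    by (simp add: proj_form_scale_left proj_form_scale_right power2_eq_square)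
  then show ?thesis
    using integral_proj_form_diag[OF v] by (simp add: r_def)
qed simp

section \<open>Second moment of the projected direction\<close>

text \<open>The norm is expanded over an orthonormal basis of \<open>S\<close>. Each basis vector
  splits into a multiple of \<open>u\<close>, controlled by the diagonal moment, and a part
  orthogonal to \<open>u\<close>, controlled by the off-diagonal one. The squared coefficients along
  \<open>u\<close> sum to |A u|^2, which is at most 1.\<close>

lemma integral_projection_stiefel_proj_unit_le:
  assumes A: "orthogonal_projection_onto A S" and u: "norm u = 1" and n: "CARD('n) \<ge> 2"
  shows "(\<integral>P. (norm (A *v ((P ** transpose P) *v u)))\<^sup>2 \<partial>\<mu>)
    \<le> 2 * (real CARD('d) * (real CARD('d) + 2) / (real CARD('n) * (real CARD('n) + 2)))
      + 2 * real (dim S) * (real CARD('d) / (real CARD('n) * (real CARD('n) - 1)))"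
proof -
  let ?n = "real CARD('n)" and ?d = "real CARD('d)"
  define m where "m = ?d * (?d + 2) / (?n * (?n + 2))"
  define c where "c = ?d / (?n * (?n - 1))"
  have n1: "?n - 1 > 0" using n by linarith
  obtain B where B: "finite B" "card B = dim S" "\<And>b. b \<in> B \<Longrightarrow> norm b = 1"
    and norm_A: "\<And>x. (norm (A *v x))\<^sup>2 = (\<Sum>b\<in>B. (b \<bullet> x)\<^sup>2)"
    using orthogonal_projection_orthonormal_basis[OF A] by metis
  have bound: "(\<integral>P. (proj_form P b u)\<^sup>2 \<partial>\<mu>) \<le> 2 * (b \<bullet> u)\<^sup>2 * m + 2 * c" if "b \<in> B" for b
  proof -
    define a where "a = b \<bullet> u"
    define w where "w = b - a *\<^sub>R u"
    have uu: "u \<bullet> u = 1" using u by (simp add: norm_eq_1)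
    have bw: "b = a *\<^sub>R u + w" by (simp add: w_def)
    have uw: "u \<bullet> w = 0"
      by (simp add: w_def a_def inner_diff_right uu inner_commute)
    have "(norm b)\<^sup>2 = a\<^sup>2 + (norm w)\<^sup>2"
      using norm_add_Pythagorean[of "a *\<^sub>R u" w] uw u by (simp add: bw orthogonal_def)
    then have w1: "(norm w)\<^sup>2 \<le> 1"
      using B(3)[OF that] by (metis le_add_same_cancel2 power_one zero_le_power2)
    have "(?n - 1) * (\<integral>P. (proj_form P u w)\<^sup>2 \<partial>\<mu>) \<le> ?d / ?n * (norm w)\<^sup>2"
      by (rule integral_proj_form_offdiag_square_le[OF uw u])
    also have "\<dots> \<le> ?d / ?n * 1"
      by (intro mult_left_mono w1) simp
    finally have wc: "(\<integral>P. (proj_form P u w)\<^sup>2 \<partial>\<mu>) \<le> c"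
      using n1 by (simp add: c_def field_simps)
    have "(proj_form P b u)\<^sup>2 \<le> 2 * a\<^sup>2 * (proj_form P u u)\<^sup>2 + 2 * (proj_form P u w)\<^sup>2" for P :: "real^'d^'n"
    proof -
      \<comment> \<open>This inequality avoids computing the mixed moment of the two parts and is
        the source of both factors 2 in the bound.\<close>
      have "(x + y)\<^sup>2 \<le> 2 * x\<^sup>2 + 2 * y\<^sup>2" for x y :: real
        using sum_squares_bound[of x y] by (simp add: power2_sum)
      from this[of "a * proj_form P u u" "proj_form P u w"] show ?thesis
        by (simp add: bw proj_form_add_left proj_form_scale_left power_mult_distrib proj_form_commute[of P w])
    qed
    then have "(\<integral>P. (proj_form P b u)\<^sup>2 \<partial>\<mu>)
        \<le> (\<integral>P. 2 * a\<^sup>2 * (proj_form P u u)\<^sup>2 + 2 * (proj_form P u w)\<^sup>2 \<partial>\<mu>)"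
      by (intro integral_mono integrable_continuous continuous_intros)
    also have "\<dots> = 2 * a\<^sup>2 * m + 2 * (\<integral>P. (proj_form P u w)\<^sup>2 \<partial>\<mu>)"
      by (subst Bochner_Integration.integral_add, (intro integrable_continuous continuous_intros)+)
        (simp add: integral_proj_form_diag_square[OF u] m_def)
    finally show ?thesis
      using wc by (simp add: a_def)
  qed
  have m0: "m \<ge> 0" by (simp add: m_def)
  have "(\<integral>P. (norm (A *v ((P ** transpose P) *v u)))\<^sup>2 \<partial>\<mu>) = (\<Sum>b\<in>B. \<integral>P. (proj_form P b u)\<^sup>2 \<partial>\<mu>)"
    by (simp only: norm_A flip: proj_form_eq_inner)
      (intro Bochner_Integration.integral_sum integrable_continuous continuous_intros)
  also have "\<dots> \<le> (\<Sum>b\<in>B. 2 * (b \<bullet> u)\<^sup>2 * m + 2 * c)"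
    by (intro sum_mono bound)
  also have "\<dots> = 2 * m * (norm (A *v u))\<^sup>2 + 2 * real (dim S) * c"
    by (simp add: norm_A sum.distrib sum_distrib_left B(2) algebra_simps)
  also have "\<dots> \<le> 2 * m * 1 + 2 * real (dim S) * c"
    using norm_orthogonal_projection_le[OF A, of u] u m0
    by (intro add_right_mono mult_left_mono) (auto simp: power_le_one)
  finally show ?thesis by (simp add: m_def c_def)
qed

text \<open>From 16 d \<le> s and d \<ge> 1 follow d + 2 \<le> s and n - 1 \<ge> n/2. The two terms
  of the unit-vector bound are then at most 2sd/n^2 and 4sd/n^2; general \<open>u\<close> follows by
  scaling.\<close>

lemma integral_projection_stiefel_proj_le:
  assumes A: "orthogonal_projection_onto A S" and d: "16 * CARD('d) \<le> dim S"
  shows "(\<integral>P. (norm (A *v ((P ** transpose P) *v u)))\<^sup>2 \<partial>\<mu>)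
    \<le> 18 * real (dim S) * real CARD('d) / (real CARD('n))\<^sup>2 * (norm u)\<^sup>2"
proof (cases "u = 0")
  case False
  let ?n = "real CARD('n)" and ?d = "real CARD('d)" and ?s = "real (dim S)"
  define v where "v = u /\<^sub>R norm u"
  define r where "r = norm u"
  have v: "norm v = 1" and u: "u = r *\<^sub>R v"
    using False by (simp_all add: v_def r_def)
  have d1: "?d \<ge> 1" by (simp add: Suc_leI)
  have s: "16 * ?d \<le> ?s" using d by linarith
  have "dim S \<le> CARD('n)"
    using dim_subset_UNIV[of S] by simp
  then have n: "?n \<ge> 16" and n2: "CARD('n) \<ge> 2"
    using s d1 by linarith+
  have "?d * (?d + 2) / (?n * (?n + 2)) \<le> ?d * (?d + 2) / (?n * ?n)"
    using n by (intro divide_left_mono mult_left_mono mult_pos_pos) auto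
  also have "\<dots> \<le> ?d * ?s / (?n * ?n)"
    using s d1 by (intro divide_right_mono mult_left_mono) (linarith | simp)+
  finally have 1: "?d * (?d + 2) / (?n * (?n + 2)) \<le> ?d * ?s / (?n * ?n)" .
  have "?d / (?n * (?n - 1)) \<le> ?d / (?n * (?n / 2))"
    using n by (intro divide_left_mono mult_left_mono mult_pos_pos) auto
  then have "?s * (?d / (?n * (?n - 1))) \<le> ?s * (?d / (?n * (?n / 2)))"
    by (intro mult_left_mono) auto
  also have "\<dots> = 2 * (?d * ?s / (?n * ?n))"
    by simp
  finally have 2: "?s * (?d / (?n * (?n - 1))) \<le> 2 * (?d * ?s / (?n * ?n))" .
  have "2 * a + 2 * r * b \<le> 6 * c" if "a \<le> c" "r * b \<le> 2 * c" for a b c r :: real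
    using that by (simp add: mult.assoc)
  from this[OF 1 2] have "2 * (?d * (?d + 2) / (?n * (?n + 2))) + 2 * ?s * (?d / (?n * (?n - 1)))
      \<le> 6 * (?d * ?s / (?n * ?n))" .
  \<comment> \<open>The constant is raised to the 18 that occurs in the step size.\<close>
  also have "\<dots> \<le> 18 * (?d * ?s / (?n * ?n))"
    by (intro mult_right_mono) auto
  finally have bound: "(\<integral>P. (norm (A *v ((P ** transpose P) *v v)))\<^sup>2 \<partial>\<mu>) \<le> 18 * ?s * ?d / ?n\<^sup>2"
    using integral_projection_stiefel_proj_unit_le[OF A v n2]
    by (simp add: power2_eq_square mult_ac)
  have scale: "(norm (A *v ((P ** transpose P) *v u)))\<^sup>2
      = (norm (A *v ((P ** transpose P) *v v)))\<^sup>2 * (norm u)\<^sup>2" for P :: "real^'d^'n"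
    unfolding u by (simp add: matrix_vector_mult_scaleR power_mult_distrib v)
  show ?thesis
    unfolding scale integral_mult_left_zero using bound by (rule mult_right_mono) simp
qed simp

end

subsection \<open>Smooth functions\<close>

text \<open>\<open>grad\<close> is a definite description, so existence and uniqueness are both
  required. The coefficients of \<open>v\<close> are the values of the derivative on the basis, as
  in the Riesz representation.\<close>

lemma L_smooth_GDERIV:
  assumes "L_smooth L f"
  shows "GDERIV f x :> grad f x"
proof -
  obtain D where D: "(f has_derivative D) (at x)"
    using assms unfolding L_smooth_def differentiable_def by blast
  then have lin: "linear D" by (rule has_derivative_linear)
  define v where "v = (\<Sum>b\<in>Basis. D b *\<^sub>R b)"
  have "D = (\<lambda>h. h \<bullet> v)"
  proof
    fix h
    have "D h = D (\<Sum>b\<in>Basis. (h \<bullet> b) *\<^sub>R b)" by (simp add: euclidean_representation)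
    also have "\<dots> = h \<bullet> v"
      using lin by (simp add: linear_sum linear_cmul v_def inner_sum_right mult.commute)
    finally show "D h = h \<bullet> v" .
  qed
  with D have v: "GDERIV f x :> v"
    by (simp add: gderiv_def)
  moreover have "w = v" if "GDERIV f x :> w" for w
  proof -
    have "(\<lambda>h. h \<bullet> w) = (\<lambda>h. h \<bullet> v)"
      using that v unfolding gderiv_def by (rule has_derivative_unique)
    then show ?thesis by (metis vector_eq_rdot inner_commute)
  qed
  ultimately show ?thesis
    unfolding grad_def by (rule theI2[where a=v]) auto
qed

lemma L_smooth_continuous_on:
  assumes "L_smooth L f"
  shows "continuous_on S f"
  using assms by (simp add: L_smooth_def differentiable_imp_continuous_within
      continuous_at_imp_continuous_on)

lemma L_smooth_continuous_on_grad:
  assumes "L_smooth L f"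
  shows "continuous_on UNIV (grad f)"
proof -
  \<comment> \<open>The absolute value is taken because \<open>lipschitz_on\<close> demands a
    nonnegative constant.\<close>
  have "\<bar>L\<bar>-lipschitz_on UNIV (grad f)"
  proof (rule lipschitz_onI)
    fix x y
    have "norm (grad f x - grad f y) \<le> L * norm (x - y)"
      using assms by (simp add: L_smooth_def)
    also have "\<dots> \<le> \<bar>L\<bar> * norm (x - y)"
      by (intro mult_right_mono) auto
    finally show "dist (grad f x) (grad f y) \<le> \<bar>L\<bar> * dist x y"
      by (simp add: dist_norm)
  qed simp
  then show ?thesis by (rule lipschitz_on_continuous_on)
qed

lemma L_smooth_line_derivative:
  assumes "L_smooth L f"
  shows "((\<lambda>t. f (x + t *\<^sub>R h)) has_real_derivative grad f (x + t *\<^sub>R h) \<bullet> h) (at t)"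
proof -
  have "(f has_derivative (\<lambda>h. h \<bullet> grad f (x + t *\<^sub>R h'))) (at (x + t *\<^sub>R h'))" for h'
    using L_smooth_GDERIV[OF assms] by (simp add: gderiv_def)
  moreover have "((\<lambda>t. x + t *\<^sub>R h) has_derivative (\<lambda>t. t *\<^sub>R h)) (at t)"
    by (auto intro!: derivative_eq_intros)
  ultimately have "((\<lambda>t. f (x + t *\<^sub>R h)) has_derivative (\<lambda>r. (r *\<^sub>R h) \<bullet> grad f (x + t *\<^sub>R h))) (at t)"
    by (rule has_derivative_compose[rotated])
  then show ?thesis
    by (simp add: has_field_derivative_def inner_commute mult_commute_abs)
qed

lemma L_smooth_descent:
  assumes "L_smooth L f"
  shows "f (x + h) \<le> f x + grad f x \<bullet> h + L / 2 * (norm h)\<^sup>2"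
proof -
  \<comment> \<open>\<phi> is f along the segment minus its quadratic upper model. Its derivative is
    nonpositive for t \<ge> 0, so comparing \<phi> at 0 and 1 gives the claim without an
    integral.\<close>
  define \<phi> where "\<phi> t = f (x + t *\<^sub>R h) - t * (grad f x \<bullet> h) - L / 2 * (norm h)\<^sup>2 * t\<^sup>2" for t
  have der: "(\<phi> has_real_derivative (grad f (x + t *\<^sub>R h) \<bullet> h - grad f x \<bullet> h - L * (norm h)\<^sup>2 * t)) (at t)" for t
    unfolding \<phi>_def by (rule derivative_eq_intros L_smooth_line_derivative[OF assms] refl)+ simp
  have le: "grad f (x + t *\<^sub>R h) \<bullet> h - grad f x \<bullet> h - L * (norm h)\<^sup>2 * t \<le> 0" if "0 \<le> t" for t
  proof -
    have "(grad f (x + t *\<^sub>R h) - grad f x) \<bullet> h \<le> norm (grad f (x + t *\<^sub>R h) - grad f x) * norm h"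
      by (rule norm_cauchy_schwarz)
    also have "\<dots> \<le> (L * norm (x + t *\<^sub>R h - x)) * norm h"
      using assms unfolding L_smooth_def by (intro mult_right_mono) (blast | simp)+
    also have "\<dots> = L * (norm h)\<^sup>2 * t"
      using that by (simp add: power2_eq_square)
    finally show ?thesis by (simp add: inner_diff_left)
  qed
  have "\<phi> 1 \<le> \<phi> 0"
    by (rule DERIV_nonpos_imp_nonincreasing[of 0 1 \<phi>]) (use der le in force)+
  then show ?thesis by (simp add: \<phi>_def)
qed

text \<open>Since f is the same along h and along A h, the descent inequality for A h bounds the
  step h. The quadratic term then contains only |A h|, which is what makes the longer step size
  admissible.\<close>

lemma L_smooth_descent_projection:
  assumes f: "L_smooth L f" and A: "orthogonal_projection_onto A S" and inv: "\<And>x. f x = f (A *v x)"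
  shows "f (x + h) \<le> f x + grad f x \<bullet> h + L / 2 * (norm (A *v h))\<^sup>2"
proof -
  have shift: "f (x + t *\<^sub>R h) = f (x + t *\<^sub>R (A *v h))" for t
    by (subst (1 2) inv)
      (simp add: matrix_vector_right_distrib matrix_vector_mult_scaleR orthogonal_projection_idem[OF A])
  \<comment> \<open>By \<open>shift\<close> the two sides are derivatives at t = 0 of one and the
    same function of t.\<close>
  have "grad f x \<bullet> h = grad f x \<bullet> (A *v h)"
    using L_smooth_line_derivative[OF f, of x h 0] L_smooth_line_derivative[OF f, of x "A *v h" 0]
    unfolding shift by (simp add: DERIV_unique)
  moreover have "f (x + h) = f (x + A *v h)"
    using shift[of 1] by simp
  ultimately show ?thesis
    using L_smooth_descent[OF f, of x "A *v h"] by simp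
qed

subsection \<open>Stochastic subspace descent\<close>

context prob_space
begin

text \<open>Almost surely the pair lies in the product of a closed ball and the Stiefel manifold.
  This set is compact, so \<open>h\<close> is bounded on it.\<close>

lemma integrable_continuous_bounded_stiefel:
  fixes X :: "'a \<Rightarrow> 'v::euclidean_space" and P :: "'a \<Rightarrow> real^'d^'n"
    and h :: "'v \<times> (real^'d^'n) \<Rightarrow> real"
  assumes "continuous_on UNIV h"
    and [measurable]: "X \<in> borel_measurable M" "P \<in> borel_measurable M"
    and X: "AE \<omega> in M. norm (X \<omega>) \<le> B" and P: "AE \<omega> in M. P \<omega> \<in> stiefel"
  shows "integrable M (\<lambda>\<omega>. h (X \<omega>, P \<omega>))"
proof -
  have "bounded (h ` (cball 0 B \<times> stiefel))"
    using assms(1) compact_stiefel continuous_on_subset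
    by (intro compact_imp_bounded compact_continuous_image compact_Times compact_cball) auto
  then obtain C where C: "\<And>y Q. norm y \<le> B \<Longrightarrow> Q \<in> stiefel \<Longrightarrow> norm (h (y, Q)) \<le> C"
    by (force simp: bounded_iff)
  have "(\<lambda>\<omega>. h (X \<omega>, P \<omega>)) \<in> borel_measurable M"
    using assms(1) by (intro borel_measurable_continuous_Pair[where H="\<lambda>x y. h (x, y)"]) auto
  then show ?thesis
    using X P C by (intro integrable_const_bound[of _ C]) auto
qed

text \<open>Independence is stated as a product law, so Fubini's theorem takes the place of
  conditioning on \<open>X\<close>: the moment bounds are applied to \<open>P\<close> with the
  gradient held fixed, and the result is averaged over \<open>X\<close>.\<close>

lemma expected_descent:
  fixes X :: "'a \<Rightarrow> real^'n" and P :: "'a \<Rightarrow> real^'d^'n"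
  assumes f: "L_smooth L f" and L: "L > 0"
    and A: "orthogonal_projection_onto A S" and inv: "\<And>x. f x = f (A *v x)"
    and d: "16 * CARD('d) \<le> dim S"
    and \<alpha>: "\<alpha> = real CARD('n) / (18 * real (dim S) * L)"
    and [measurable]: "X \<in> borel_measurable M" "P \<in> borel_measurable M"
    and indep: "distr M borel X \<Otimes>\<^sub>M distr M borel P = distr M (borel \<Otimes>\<^sub>M borel) (\<lambda>\<omega>. (X \<omega>, P \<omega>))"
    and haar: "haar_stiefel (distr M borel P)"
    and X: "AE \<omega> in M. norm (X \<omega>) \<le> B"
  shows "expectation (\<lambda>\<omega>. f (X \<omega> - \<alpha> *\<^sub>R ((P \<omega> ** transpose (P \<omega>)) *v grad f (X \<omega>))))
    \<le> expectation (\<lambda>\<omega>. f (X \<omega>))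
      - real CARD('d) / (36 * L * real (dim S)) * expectation (\<lambda>\<omega>. (norm (grad f (X \<omega>)))\<^sup>2)"
proof -
  let ?n = "real CARD('n)" and ?d = "real CARD('d)" and ?s = "real (dim S)"
  let ?W = "\<lambda>Q::real^'d^'n. Q ** transpose Q"
  define \<eta> where "\<eta> = ?d / (36 * L * ?s)"
  define \<Phi> where "\<Phi> = (\<lambda>(y, Q). - \<alpha> * (grad f y \<bullet> (?W Q *v grad f y))
    + L * \<alpha>\<^sup>2 / 2 * (norm (A *v (?W Q *v grad f y)))\<^sup>2)"
  define \<mu> where "\<mu> = distr M borel P"
  define \<nu> where "\<nu> = distr M borel X"
  interpret \<mu>: haar_stiefel_measure \<mu>
    by unfold_locales (simp add: \<mu>_def haar)
  interpret \<nu>: prob_space \<nu>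
    unfolding \<nu>_def by (rule prob_space_distr) simp
  interpret pair_sigma_finite \<nu> \<mu> ..
  \<comment> \<open>Passing from the law of \<open>P\<close> back to \<open>M\<close> requires the
    Stiefel manifold to be measurable; it is compact, hence closed.\<close>
  have P: "AE \<omega> in M. P \<omega> \<in> stiefel"
    using \<mu>.AE_stiefel compact_stiefel
    by (subst (asm) \<mu>_def, subst (asm) AE_distr_iff) (auto intro: borel_closed compact_imp_closed)
  have grad: "continuous_on T (grad f)" for T
    using L_smooth_continuous_on_grad[OF f] continuous_on_subset by blast
  note cont [continuous_intros] = continuous_on_compose2[OF grad[of UNIV]] continuous_on_compose2[OF L_smooth_continuous_on[OF f, of UNIV]]
  note int = integrable_continuous_bounded_stiefel[OF _ _ _ X P]
  have \<Phi>: "continuous_on UNIV \<Phi>"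
    unfolding \<Phi>_def split_beta by (intro continuous_intros) auto
  have int_f: "integrable M (\<lambda>\<omega>. f (X \<omega>))"
    using int[of "\<lambda>z. f (fst z)"] by (simp add: continuous_intros)
  have int_next: "integrable M (\<lambda>\<omega>. f (X \<omega> - \<alpha> *\<^sub>R (?W (P \<omega>) *v grad f (X \<omega>))))"
    using int[of "\<lambda>z. f (fst z - \<alpha> *\<^sub>R (?W (snd z) *v grad f (fst z)))"]
    by (simp add: continuous_intros)
  have int_grad: "integrable M (\<lambda>\<omega>. (norm (grad f (X \<omega>)))\<^sup>2)"
    using int[of "\<lambda>z. (norm (grad f (fst z)))\<^sup>2"] by (simp add: continuous_intros)
  have int_\<Phi>: "integrable M (\<lambda>\<omega>. \<Phi> (X \<omega>, P \<omega>))"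
    using int[OF \<Phi>] by simp
  have \<Phi>_borel [measurable]: "\<Phi> \<in> borel_measurable (borel \<Otimes>\<^sub>M borel)"
    using borel_measurable_continuous_onI[OF \<Phi>] by (simp add: borel_prod)
  have joint: "\<nu> \<Otimes>\<^sub>M \<mu> = distr M (borel \<Otimes>\<^sub>M borel) (\<lambda>\<omega>. (X \<omega>, P \<omega>))"
    using indep by (simp add: \<nu>_def \<mu>_def)
  have int_pair: "integrable (\<nu> \<Otimes>\<^sub>M \<mu>) \<Phi>"
    unfolding joint using int_\<Phi> by (subst integrable_distr_eq) simp_all
  have inner: "(\<integral>Q. \<Phi> (y, Q) \<partial>\<mu>) \<le> - \<eta> * (norm (grad f y))\<^sup>2" for y
  proof -
    let ?g = "grad f y"
    have s: "?s > 0" using d zero_less_card_finite[where 'a='d] by linarith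
    have "(\<integral>Q. \<Phi> (y, Q) \<partial>\<mu>) = - \<alpha> * (\<integral>Q. ?g \<bullet> (?W Q *v ?g) \<partial>\<mu>)
        + L * \<alpha>\<^sup>2 / 2 * (\<integral>Q. (norm (A *v (?W Q *v ?g)))\<^sup>2 \<partial>\<mu>)"
      unfolding \<Phi>_def prod.case
      by (subst Bochner_Integration.integral_add, (intro \<mu>.integrable_continuous continuous_intros)+) simp
    also have "\<dots> \<le> - \<alpha> * (?d / ?n * (norm ?g)\<^sup>2)
        + L * \<alpha>\<^sup>2 / 2 * (18 * ?s * ?d / ?n\<^sup>2 * (norm ?g)\<^sup>2)"
      unfolding \<mu>.integral_inner_stiefel_proj using L
      by (intro add_left_mono mult_left_mono \<mu>.integral_projection_stiefel_proj_le[OF A d]) simp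
    \<comment> \<open>For \<alpha> = n/(18sL) the linear term is -d/(18sL) and the quadratic term is
      d/(36sL), each times the squared gradient norm. Half of the linear gain survives.\<close>
    also have "\<dots> = - \<eta> * (norm ?g)\<^sup>2"
      using L s by (simp add: \<alpha> \<eta>_def field_simps power2_eq_square)
    finally show ?thesis .
  qed
  have "expectation (\<lambda>\<omega>. \<Phi> (X \<omega>, P \<omega>)) = (\<integral>z. \<Phi> z \<partial>(\<nu> \<Otimes>\<^sub>M \<mu>))"
    unfolding joint by (subst integral_distr) simp_all
  also have "\<dots> = (\<integral>y. (\<integral>Q. \<Phi> (y, Q) \<partial>\<mu>) \<partial>\<nu>)"
    using int_pair by (rule integral_fst'[symmetric])
  also have "\<dots> \<le> (\<integral>y. - \<eta> * (norm (grad f y))\<^sup>2 \<partial>\<nu>)"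
  proof (rule integral_mono)
    show "integrable \<nu> (\<lambda>y. \<integral>Q. \<Phi> (y, Q) \<partial>\<mu>)"
      using int_pair by (rule integrable_fst')
    show "integrable \<nu> (\<lambda>y. - \<eta> * (norm (grad f y))\<^sup>2)"
      unfolding \<nu>_def using int_grad borel_measurable_continuous_onI[OF grad]
      by (subst integrable_distr_eq) simp_all
  qed (rule inner)
  also have "\<dots> = - \<eta> * expectation (\<lambda>\<omega>. (norm (grad f (X \<omega>)))\<^sup>2)"
    unfolding \<nu>_def using borel_measurable_continuous_onI[OF grad]
    by (subst integral_distr) simp_all
  finally have E\<Phi>: "expectation (\<lambda>\<omega>. \<Phi> (X \<omega>, P \<omega>)) \<le> - \<eta> * expectation (\<lambda>\<omega>. (norm (grad f (X \<omega>)))\<^sup>2)" .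
  have "f (X \<omega> - \<alpha> *\<^sub>R (?W (P \<omega>) *v grad f (X \<omega>))) \<le> f (X \<omega>) + \<Phi> (X \<omega>, P \<omega>)" for \<omega>
    using L_smooth_descent_projection[OF f A inv, of "X \<omega>" "- \<alpha> *\<^sub>R (?W (P \<omega>) *v grad f (X \<omega>))"]
    by (simp add: \<Phi>_def power_mult_distrib matrix_vector_mult_scaleR vec.neg)
  then have "expectation (\<lambda>\<omega>. f (X \<omega> - \<alpha> *\<^sub>R (?W (P \<omega>) *v grad f (X \<omega>))))
      \<le> expectation (\<lambda>\<omega>. f (X \<omega>) + \<Phi> (X \<omega>, P \<omega>))"
    by (intro integral_mono int_next Bochner_Integration.integrable_add int_f int_\<Phi>)
  also have "\<dots> = expectation (\<lambda>\<omega>. f (X \<omega>)) + expectation (\<lambda>\<omega>. \<Phi> (X \<omega>, P \<omega>))"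
    by (intro Bochner_Integration.integral_add int_f int_\<Phi>)
  finally show ?thesis
    using E\<Phi> by (simp add: \<eta>_def)
qed

end

section \<open>The iterates as functions of the past matrices\<close>

text \<open>The iterate is a deterministic function of a matrix sequence, so that its measurability
  and its dependence on the past can be treated apart from the probability space.\<close>

primrec subspace_descent ::
  "real \<Rightarrow> (real^'n \<Rightarrow> real^'n) \<Rightarrow> real^'n \<Rightarrow> (nat \<Rightarrow> real^'d^'n) \<Rightarrow> nat \<Rightarrow> real^'n"
where
  "subspace_descent \<alpha> G x0 P 0 = x0"
| "subspace_descent \<alpha> G x0 P (Suc k) = subspace_descent \<alpha> G x0 P k
    - \<alpha> *\<^sub>R ((P k ** transpose (P k)) *v G (subspace_descent \<alpha> G x0 P k))"

text \<open>Only the first k matrices influence iterate k, so the sequence may be restricted to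
  them.\<close>

lemma subspace_descent_cong:
  assumes "\<And>i. i < k \<Longrightarrow> P i = Q i"
  shows "subspace_descent \<alpha> G x0 P k = subspace_descent \<alpha> G x0 Q k"
  using assms by (induction k) auto

text \<open>Any index set \<open>K\<close> containing the first k indices is allowed, so that the
  induction can stay on one product space.\<close>

lemma measurable_subspace_descent:
  fixes G :: "real^'n \<Rightarrow> real^'n"
  assumes G: "continuous_on UNIV G" and "{..<k} \<subseteq> K"
  shows "(\<lambda>P. subspace_descent \<alpha> G x0 P k)
    \<in> borel_measurable (Pi\<^sub>M K (\<lambda>_. borel :: (real^'d^'n) measure))"
  using assms(2)
proof (induction k)
  case (Suc k)
  have "(\<lambda>P. P k) \<in> borel_measurable (Pi\<^sub>M K (\<lambda>_. borel :: (real^'d^'n) measure))"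
    using Suc.prems by (intro measurable_component_singleton) auto
  moreover have "(\<lambda>P. subspace_descent \<alpha> G x0 P k)
      \<in> borel_measurable (Pi\<^sub>M K (\<lambda>_. borel :: (real^'d^'n) measure))"
    using Suc.prems by (intro Suc.IH) auto
  moreover have "continuous_on UNIV (\<lambda>z. fst z - \<alpha> *\<^sub>R ((snd z ** transpose (snd z :: real^'d^'n)) *v G (fst z)))"
    by (intro continuous_intros continuous_on_compose2[OF G]) auto
  ultimately show ?case
    by (simp add: borel_measurable_continuous_Pair[where
          H="\<lambda>x P. x - \<alpha> *\<^sub>R ((P ** transpose P) *v G x)"])
qed simp

text \<open>Iterate k is a function of the matrices with index below k. These are jointly
  independent of \<open>P k\<close>, and pushing the product law of past and present forward
  preserves the product form.\<close>

lemma (in prob_space)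
  fixes P :: "nat \<Rightarrow> 'a \<Rightarrow> real^'d^'n" and \<alpha> :: real and x0 :: "real^'n"
  assumes indep: "indep_vars (\<lambda>_. borel) P UNIV" and G: "continuous_on UNIV G"
  defines "X \<equiv> \<lambda>k \<omega>. subspace_descent \<alpha> G x0 (\<lambda>i. P i \<omega>) k"
  shows random_variable_subspace_descent: "X k \<in> borel_measurable M"
    and distr_pair_subspace_descent: "distr M borel (X k) \<Otimes>\<^sub>M distr M borel (P k)
      = distr M (borel \<Otimes>\<^sub>M borel) (\<lambda>\<omega>. (X k \<omega>, P k \<omega>))"
proof -
  let ?past = "\<lambda>\<omega>. restrict (\<lambda>i. P i \<omega>) {..<k}" and ?now = "\<lambda>\<omega>. restrict (\<lambda>i. P i \<omega>) {k}"
  let ?PiM = "\<lambda>K. Pi\<^sub>M K (\<lambda>_::nat. borel :: (real^'d^'n) measure)"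
  have "indep_var (?PiM {..<k}) ?past (?PiM {k}) ?now"
    by (intro indep_var_restrict[OF indep]) auto
  then have rv [measurable]: "?past \<in> measurable M (?PiM {..<k})" "?now \<in> measurable M (?PiM {k})"
    and joint: "distr M (?PiM {..<k}) ?past \<Otimes>\<^sub>M distr M (?PiM {k}) ?now
      = distr M (?PiM {..<k} \<Otimes>\<^sub>M ?PiM {k}) (\<lambda>\<omega>. (?past \<omega>, ?now \<omega>))"
    by (simp_all add: indep_var_distribution_eq)
  have meas [measurable]: "(\<lambda>P. subspace_descent \<alpha> G x0 P k) \<in> borel_measurable (?PiM {..<k})"
      "(\<lambda>P. P k) \<in> borel_measurable (?PiM {k})"
    by (auto intro: measurable_subspace_descent[OF G])
  have X: "X k = (\<lambda>P. subspace_descent \<alpha> G x0 P k) \<circ> ?past"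
    by (rule ext) (auto simp: X_def intro!: subspace_descent_cong)
  have P: "P k = (\<lambda>P. P k) \<circ> ?now"
    by auto
  show "X k \<in> borel_measurable M"
    unfolding X by (rule measurable_comp) measurable
  \<comment> \<open>This supplies the sigma-finiteness that \<open>pair_measure_distr\<close>
    requires of its second factor.\<close>
  interpret now: prob_space "distr (distr M (?PiM {k}) ?now) borel (\<lambda>P. P k)"
    by (intro prob_space.prob_space_distr prob_space_distr) measurable
  have distr_X: "distr M borel (X k)
      = distr (distr M (?PiM {..<k}) ?past) borel (\<lambda>P. subspace_descent \<alpha> G x0 P k)"
    by (subst X) (rule distr_distr[OF meas(1) rv(1), symmetric])
  have distr_P: "distr M borel (P k) = distr (distr M (?PiM {k}) ?now) borel (\<lambda>P. P k)"
    by (subst P) (rule distr_distr[OF meas(2) rv(2), symmetric])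
  have "distr M borel (X k) \<Otimes>\<^sub>M distr M borel (P k)
      = distr (distr M (?PiM {..<k}) ?past) borel (\<lambda>P. subspace_descent \<alpha> G x0 P k)
        \<Otimes>\<^sub>M distr (distr M (?PiM {k}) ?now) borel (\<lambda>P. P k)"
    by (simp only: distr_X distr_P)
  also have "\<dots> = distr (distr M (?PiM {..<k}) ?past \<Otimes>\<^sub>M distr M (?PiM {k}) ?now) (borel \<Otimes>\<^sub>M borel)
      (\<lambda>(p, q). (subspace_descent \<alpha> G x0 p k, q k))"
    by (rule pair_measure_distr) (measurable, unfold_locales)
  also have "\<dots> = distr M (borel \<Otimes>\<^sub>M borel) ((\<lambda>(p, q). (subspace_descent \<alpha> G x0 p k, q k)) \<circ> (\<lambda>\<omega>. (?past \<omega>, ?now \<omega>)))"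
    unfolding joint by (rule distr_distr) measurable
  also have "(\<lambda>(p, q). (subspace_descent \<alpha> G x0 p k, q k)) \<circ> (\<lambda>\<omega>. (?past \<omega>, ?now \<omega>))
      = (\<lambda>\<omega>. (X k \<omega>, P k \<omega>))"
    by (auto simp: X)
  finally show "distr M borel (X k) \<Otimes>\<^sub>M distr M borel (P k)
      = distr M (borel \<Otimes>\<^sub>M borel) (\<lambda>\<omega>. (X k \<omega>, P k \<omega>))" .
qed

text \<open>By induction the previous iterate stays in a ball, on which the continuous map
  \<open>G\<close> is bounded. Since P P^T does not increase norms, one step adds at most a
  constant.\<close>

lemma AE_bounded_subspace_descent:
  fixes P :: "nat \<Rightarrow> 'a \<Rightarrow> real^'d^'n"
  assumes P: "\<And>k. AE \<omega> in M. P k \<omega> \<in> stiefel" and G: "continuous_on UNIV G"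
  shows "\<exists>B. AE \<omega> in M. norm (subspace_descent \<alpha> G x0 (\<lambda>i. P i \<omega>) k) \<le> B"
proof (induction k)
  case (Suc k)
  then obtain B where B: "AE \<omega> in M. norm (subspace_descent \<alpha> G x0 (\<lambda>i. P i \<omega>) k) \<le> B" ..
  have "bounded (G ` cball 0 B)"
    using G continuous_on_subset by (intro compact_imp_bounded compact_continuous_image compact_cball) auto
  then obtain C where C: "\<And>y. norm y \<le> B \<Longrightarrow> norm (G y) \<le> C"
    by (force simp: bounded_iff)
  have step: "norm (y - \<alpha> *\<^sub>R ((Q ** transpose Q) *v G y)) \<le> B + \<bar>\<alpha>\<bar> * C"
    if "norm y \<le> B" "Q \<in> stiefel" for y and Q :: "real^'d^'n"
  proof -
    have "norm ((Q ** transpose Q) *v G y) \<le> C"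
      using norm_stiefel_proj_le[OF that(2)] C[OF that(1)] by (rule order_trans)
    then have "norm (\<alpha> *\<^sub>R ((Q ** transpose Q) *v G y)) \<le> \<bar>\<alpha>\<bar> * C"
      by (simp add: mult_left_mono)
    then show ?thesis
      using that(1) norm_triangle_ineq4 by (meson add_mono order_trans)
  qed
  have "AE \<omega> in M. norm (subspace_descent \<alpha> G x0 (\<lambda>i. P i \<omega>) (Suc k)) \<le> B + \<bar>\<alpha>\<bar> * C"
    using B P[of k] by eventually_elim (simp add: step)
  then show ?case ..
qed auto

section \<open>Telescoping and the iteration count\<close>

theorem theorem6:
  fixes f :: "real^'n \<Rightarrow> real"
    and M :: "'a measure"
    and P :: "nat \<Rightarrow> 'a \<Rightarrow> real^'d^'n"
    and x :: "nat \<Rightarrow> 'a \<Rightarrow> real^'n"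
    and x0 :: "real^'n"
    and L \<alpha> \<epsilon> fstar :: real
    and s N :: nat
  assumes "L > 0" and "L_smooth L f"
    and "bdd_below (range f)" and "fstar = (INF y. f y)"
    and "s < CARD('n)" and "intrinsic_dimension f s"
    and "prob_space M"
    and "prob_space.indep_vars M (\<lambda>_. borel) P UNIV"
    and "\<And>k. haar_stiefel (distr M borel (P k))"
    and "\<And>\<omega>. \<omega> \<in> space M \<Longrightarrow> x 0 \<omega> = x0"
    and "\<And>k \<omega>. k \<ge> 1 \<Longrightarrow> \<omega> \<in> space M \<Longrightarrow>
           x k \<omega> = x (k - 1) \<omega> -
             \<alpha> *\<^sub>R ((P (k - 1) \<omega> ** transpose (P (k - 1) \<omega>)) *v grad f (x (k - 1) \<omega>))"
    and "max 1 (2 * ln (2 * real CARD('n) ^ 2 / (9 * real s))) \<le> real CARD('d)"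
    and "real CARD('d) \<le> real s / 16"
    and "\<alpha> = real CARD('n) / (18 * real s * L)"
    and "\<epsilon> > 0"
    and "N \<ge> 1"
    and "real N \<ge> 36 * L * real s / (real CARD('d) * \<epsilon> ^ 2) * (f x0 - fstar)"
  shows "Min ((\<lambda>k. prob_space.expectation M (\<lambda>\<omega>. norm (grad f (x (k - 1) \<omega>)) ^ 2)) ` {1..N}) \<le> \<epsilon> ^ 2"
proof -
  interpret prob_space M by fact
  note f = \<open>L_smooth L f\<close> and L = \<open>L > 0\<close>
  obtain A S where A: "orthogonal_projection_onto A S" and dim: "dim S = s"
    and inv: "\<And>x. f x = f (A *v x)"
    using assms(6) unfolding intrinsic_dimension_def by blast
  note G = L_smooth_continuous_on_grad[OF f]
  define X where "X k \<omega> = subspace_descent \<alpha> (grad f) x0 (\<lambda>i. P i \<omega>) k" for k \<omega>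
  define \<eta> where "\<eta> = real CARD('d) / (36 * L * real s)"
  define e where "e k = expectation (\<lambda>\<omega>. (norm (grad f (x k \<omega>)))\<^sup>2)" for k
  \<comment> \<open>The recursion is given only on the space of \<open>M\<close>, so the two
    processes are identified there; this suffices for equality of expectations.\<close>
  have x_eq: "x k \<omega> = X k \<omega>" if "\<omega> \<in> space M" for k \<omega>
  proof (induction k)
    case 0
    then show ?case using assms(10)[OF that] by (simp add: X_def)
  next
    case (Suc k)
    then show ?case using assms(11)[OF _ that, of "Suc k"] by (simp add: X_def)
  qed
  have d: "16 * CARD('d) \<le> s"
    using assms(13) by linarith
  have s: "real s > 0"
    using d zero_less_card_finite[where 'a='d] by linarith
  have \<eta>: "\<eta> > 0"
    using s L by (simp add: \<eta>_def)
  have P: "AE \<omega> in M. P k \<omega> \<in> stiefel" for k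
  proof -
    interpret \<mu>: haar_stiefel_measure "distr M borel (P k)"
      by unfold_locales (rule assms(9))
    have "P k \<in> borel_measurable M"
      using assms(8) unfolding indep_vars_def by simp
    then show ?thesis
      using \<mu>.AE_stiefel compact_stiefel
      by (subst (asm) AE_distr_iff) (auto intro: borel_closed compact_imp_closed)
  qed
  have rv_X: "X k \<in> borel_measurable M" and rv_P: "P k \<in> borel_measurable M" for k
    using random_variable_subspace_descent[OF assms(8) G] assms(8)
    unfolding X_def[abs_def] indep_vars_def by simp_all
  have bounded_X: "\<exists>B. AE \<omega> in M. norm (X k \<omega>) \<le> B" for k
    unfolding X_def by (rule AE_bounded_subspace_descent[OF P G])
  have step: "expectation (\<lambda>\<omega>. f (X (Suc k) \<omega>)) \<le> expectation (\<lambda>\<omega>. f (X k \<omega>)) - \<eta> * e k" for k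
  proof -
    obtain B where B: "AE \<omega> in M. norm (X k \<omega>) \<le> B"
      using bounded_X by blast
    have joint: "distr M borel (X k) \<Otimes>\<^sub>M distr M borel (P k)
        = distr M (borel \<Otimes>\<^sub>M borel) (\<lambda>\<omega>. (X k \<omega>, P k \<omega>))"
      unfolding X_def[abs_def] by (rule distr_pair_subspace_descent[OF assms(8) G])
    have "e k = expectation (\<lambda>\<omega>. (norm (grad f (X k \<omega>)))\<^sup>2)"
      unfolding e_def by (rule Bochner_Integration.integral_cong) (simp_all add: x_eq)
    moreover have "X (Suc k) \<omega>
        = X k \<omega> - \<alpha> *\<^sub>R ((P k \<omega> ** transpose (P k \<omega>)) *v grad f (X k \<omega>))" for \<omega>
      by (simp add: X_def)
    moreover have "\<alpha> = real CARD('n) / (18 * real (dim S) * L)" "16 * CARD('d) \<le> dim S"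
      using assms(14) d by (simp_all only: dim)
    note expected_descent[OF f L A inv this(2,1) rv_X rv_P joint assms(9) B]
    ultimately show ?thesis
      by (simp only: \<eta>_def dim)
  qed
  have telescope: "expectation (\<lambda>\<omega>. f (X m \<omega>)) \<le> f x0 - \<eta> * (\<Sum>k<m. e k)" for m
  proof (induction m)
    case (Suc m)
    then show ?case
      using step[of m] by (simp add: algebra_simps)
  qed (simp add: X_def prob_space)
  \<comment> \<open>Integrability has to be shown first: the integral of a non-integrable function
    is 0 by convention and need not respect the lower bound.\<close>
  have "fstar \<le> expectation (\<lambda>\<omega>. f (X N \<omega>))"
  proof -
    obtain B where B: "AE \<omega> in M. norm (X N \<omega>) \<le> B"
      using bounded_X by blast
    have "continuous_on UNIV (\<lambda>z :: (real^'n) \<times> (real^'d^'n). f (fst z))"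
      by (intro continuous_on_compose2[OF L_smooth_continuous_on[OF f, of UNIV]] continuous_intros) auto
    from integrable_continuous_bounded_stiefel[OF this rv_X rv_P B P]
    have "integrable M (\<lambda>\<omega>. f (X N \<omega>))"
      by simp
    moreover have "fstar \<le> f y" for y
      unfolding assms(4) using assms(3) by (simp add: cINF_lower)
    ultimately show ?thesis
      by (simp add: integral_ge_const)
  qed
  with telescope[of N] have sum: "\<eta> * (\<Sum>k<N. e k) \<le> f x0 - fstar"
    by linarith
  let ?m = "Min ((\<lambda>k. e (k - 1)) ` {1..N})"
  \<comment> \<open>The minimum runs over 1, ..., N with index k - 1, so \<open>e k\<close> is
    attained at \<open>Suc k\<close>.\<close>
  have "?m \<le> e k" if "k < N" for k
    using that by (intro Min_le) (auto intro!: image_eqI[of _ _ "Suc k"])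
  then have "real N * ?m \<le> (\<Sum>k<N. e k)"
    using sum_bounded_below[of "{..<N}" ?m e] by simp
  then have "\<eta> * (real N * ?m) \<le> f x0 - fstar"
    using \<eta> sum by (meson less_imp_le mult_left_mono order_trans)
  \<comment> \<open>This is the assumed lower bound on \<open>N\<close> multiplied by \<eta> and the
    square of \<epsilon>, since \<eta> = d/(36Ls).\<close>
  also have "\<dots> \<le> \<eta> * (real N * \<epsilon>\<^sup>2)"
    using assms(17) \<open>\<epsilon> > 0\<close> L s
    by (simp add: \<eta>_def field_simps)
  finally have "?m \<le> \<epsilon>\<^sup>2"
    using \<eta> \<open>N \<ge> 1\<close> by simp
  then show ?thesis
    by (simp add: e_def)
qed

end
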